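(* The map $r\mapsto c(r)$, $r\ge 0$, is non-increasing and Lipschitz continuous.
   Context: Let $N\ge 1$ be an integer and let $\Omega\subset\mathbb{R}^N$ be a bounded domain (open and connected) with $C^{1,1}$ boundary. $\|\cdot\|_2$ is the $L^2(\Omega)$ norm; $u^\pm=\max\{\pm u,0\}$. Put $c_N=\pi^{-N/2}\Gamma(N/2)$ and $\rho_N=2\ln 2+\psi(N/2)-\gamma$, with $\psi=\Gamma'/\Gamma$ the digamma function and $\gamma=-\Gamma'(1)$; $B_1$ is the unit ball centred at $0$, $k(z)=\mathbf 1_{B_1}(z)|z|^{-N}$, $j(z)=\mathbf 1_{\mathbb{R}^N\setminus B_1}(z)|z|^{-N}$ for $z\neq 0$. $\mathbb{H}(\Omega)$ is the Hilbert space of all $u\in L^2(\Omega)$, extended by $u=0$ in $\mathbb{R}^N\setminus\Omega$, with $\iint_{\mathbb{R}^{2N}}|u(x)-u(y)|^2k(x-y)\,dx\,dy<\infty$, with inner product $\mathcal{E}(u,v)=\frac{c_N}{2}\iint_{\mathbb{R}^{2N}}(u(x)-u(y))(v(x)-v(y))k(x-y)\,dx\,dy$ and norm $\|u\|=\mathcal{E}(u,u)^{1/2}$. The quadratic form of the logarithmic Laplacian is $$\mathcal{E}_L(u,v)=\mathcal{E}(u,v)-c_N\iint_{\mathbb{R}^{2N}}u(x)v(y)j(x-y)\,dx\,dy+\rho_N\int_{\mathbb{R}^N}uv\,dx .$$ The first eigenvalue is $\lambda_1^L=\min\{\mathcal{E}_L(u,u):u\in\mathbb{H}(\Omega),\|u\|_2=1\}$;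 it is simple, and $\varphi_1>0$ denotes the associated minimizer (eigenfunction) with $\|\varphi_1\|_2=1$. Let $\mathcal{P}=\{u\in\mathbb{H}(\Omega): \int_\Omega u^2\,dx=1\}$ (with the topology of $\mathbb{H}(\Omega)$), $E_r(u)=\mathcal{E}_L(u,u)-r\int_\Omega(u^+)^2\,dx$, $\Gamma=\{\gamma\in C([-1,1],\mathcal{P}):\gamma(-1)=-\varphi_1,\ \gamma(1)=\varphi_1\}$, and $c(r)=\inf_{\gamma\in\Gamma}\max_{u\in\gamma[-1,1]}E_r(u)$. *)

theory Defs
  imports "HOL-Analysis.Analysis"
begin

text \<open>
  The ambient space \<open>\<real>\<^sup>N\<close> is a type of class \<^class>\<open>euclidean_space\<close> with \<open>N = DIM('a)\<close>
  (so \<open>N \<ge> 1\<close> holds automatically). Elements of \<open>L\<^sup>2(\<Omega>)\<close> are given by Borel representatives that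
  vanish outside \<open>\<Omega>\<close>; equality of elements of the function spaces is equality almost everywhere.
\<close>

text \<open>
  Near each boundary point, \<open>\<Omega>\<close> is the part above the graph of a \<open>C\<^sup>1\<^sup>,\<^sup>1\<close> function over the
  hyperplane orthogonal to a unit vector \<open>e\<close>. Only the values of \<open>g\<close> on that hyperplane matter,
  a function on the hyperplane being identified with an extension of it to the whole space
  (for instance the one constant along \<open>e\<close>). If \<open>N = 1\<close>, the hyperplane is \<open>{0}\<close>.
\<close>

definition C11_boundary :: "'a::euclidean_space set \<Rightarrow> bool" where
  "C11_boundary \<Omega> \<longleftrightarrow>
     (\<forall>x0 \<in> frontier \<Omega>. \<exists>e \<delta> (g :: 'a \<Rightarrow> real) (G :: 'a \<Rightarrow> 'a) L.
        norm e = 1 \<and> \<delta> > 0 \<and>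
        (\<forall>x. (g has_derivative (\<lambda>v. G x \<bullet> v)) (at x)) \<and> L-lipschitz_on UNIV G \<and>
        \<Omega> \<inter> ball x0 \<delta> = {x \<in> ball x0 \<delta>. x \<bullet> e > g (x - (x \<bullet> e) *\<^sub>R e)})"

definition c_const :: "nat \<Rightarrow> real" where
  "c_const N = pi powr (- (real N / 2)) * Gamma (real N / 2)"

definition rho_const :: "nat \<Rightarrow> real" where
  "rho_const N = 2 * ln 2 + Digamma (real N / 2) - euler_mascheroni"

definition k_kernel :: "'a::euclidean_space \<Rightarrow> real" where
  "k_kernel z = indicator (ball 0 1) z * inverse (norm z ^ DIM('a))"

definition j_kernel :: "'a::euclidean_space \<Rightarrow> real" where
  "j_kernel z = indicator (- ball 0 1) z * inverse (norm z ^ DIM('a))"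

definition HH :: "'a::euclidean_space set \<Rightarrow> ('a \<Rightarrow> real) set" where
  "HH \<Omega> = {u. u \<in> borel_measurable borel \<and> (\<forall>x. x \<notin> \<Omega> \<longrightarrow> u x = 0) \<and>
              integrable lborel (\<lambda>x. (u x)\<^sup>2) \<and>
              integrable lborel (\<lambda>(x :: 'a, y). \<bar>u x - u y\<bar>\<^sup>2 * k_kernel (x - y))}"

definition EE :: "('a::euclidean_space \<Rightarrow> real) \<Rightarrow> ('a \<Rightarrow> real) \<Rightarrow> real" where
  "EE u v = c_const DIM('a) / 2 *
     (\<integral>(x :: 'a, y). (u x - u y) * (v x - v y) * k_kernel (x - y) \<partial>lborel)"

definition HH_norm :: "('a::euclidean_space \<Rightarrow> real) \<Rightarrow> real" where
  "HH_norm u = sqrt (EE u u)"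

definition EL :: "('a::euclidean_space \<Rightarrow> real) \<Rightarrow> ('a \<Rightarrow> real) \<Rightarrow> real" where
  "EL u v = EE u v
     - c_const DIM('a) * (\<integral>(x :: 'a, y). u x * v y * j_kernel (x - y) \<partial>lborel)
     + rho_const DIM('a) * (\<integral>x. u x * v x \<partial>lborel)"

definition PP :: "'a::euclidean_space set \<Rightarrow> ('a \<Rightarrow> real) set" where
  "PP \<Omega> = {u \<in> HH \<Omega>. (LINT x:\<Omega>|lborel. (u x)\<^sup>2) = 1}"

definition first_eigenfunction :: "'a::euclidean_space set \<Rightarrow> ('a \<Rightarrow> real) \<Rightarrow> bool" where
  "first_eigenfunction \<Omega> \<phi> \<longleftrightarrow>
     is_arg_min (\<lambda>u. EL u u) (\<lambda>u. u \<in> PP \<Omega>) \<phi> \<and> (AE x in lborel. x \<in> \<Omega> \<longrightarrow> \<phi> x > 0)"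

definition E_r :: "'a::euclidean_space set \<Rightarrow> real \<Rightarrow> ('a \<Rightarrow> real) \<Rightarrow> real" where
  "E_r \<Omega> r u = EL u u - r * (LINT x:\<Omega>|lborel. (max (u x) 0)\<^sup>2)"

text \<open>
  Since functions stand for their classes, \<^const>\<open>HH_norm\<close> is a seminorm on representatives; continuity
  of a path is continuity with respect to it, and the end points are prescribed almost everywhere.
\<close>

definition paths :: "'a::euclidean_space set \<Rightarrow> ('a \<Rightarrow> real) \<Rightarrow> (real \<Rightarrow> 'a \<Rightarrow> real) set" where
  "paths \<Omega> \<phi> = {\<gamma>.
     (\<forall>t \<in> {-1..1}. \<gamma> t \<in> PP \<Omega>) \<and>
     (\<forall>t \<in> {-1..1}. ((\<lambda>s. HH_norm (\<lambda>x. \<gamma> s x - \<gamma> t x)) \<longlongrightarrow> 0) (at t within {-1..1})) \<and>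
     (AE x in lborel. \<gamma> (-1) x = - \<phi> x) \<and>
     (AE x in lborel. \<gamma> 1 x = \<phi> x)}"

text \<open>
  The maximum is taken over an infinite set, so it is written with \<^const>\<open>Greatest\<close>
  instead of \<^const>\<open>Max\<close>.
\<close>

definition c_level :: "'a::euclidean_space set \<Rightarrow> ('a \<Rightarrow> real) \<Rightarrow> real \<Rightarrow> real" where
  "c_level \<Omega> \<phi> r = (INF \<gamma> \<in> paths \<Omega> \<phi>. GREATEST m. m \<in> E_r \<Omega> r ` \<gamma> ` {-1..1})"

end

theory Submission
  imports Defs
begin

text \<open>
  On the sphere \<open>\<P>\<close> the mass of the positive part lies between \<open>0\<close> and \<open>1\<close>, so for
  \<open>r \<le> r'\<close> one has \<open>E\<^sub>r\<^sub>' \<le> E\<^sub>r \<le> E\<^sub>r\<^sub>' + (r' - r)\<close> pointwise. Maxima along a path and infima over paths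
  preserve both inequalities, so the minimax level is non-increasing and Lipschitz with
  constant \<open>1\<close>. The infimum is a genuine one because the minimality of the first eigenvalue bounds
  \<open>E\<^sub>r\<close> below by \<open>\<lambda>\<^sub>1 - r\<close> on \<open>\<P>\<close>.

  What has to be shown is that the maximum along a path is attained, and for this that
  \<open>E\<^sub>r\<close> is continuous with respect to the norm of \<open>\<H>(\<Omega>)\<close> (\<open>tendsto_E_r\<close>). Every term of \<open>E\<^sub>r\<close> is the
  integral of a product of two functions that depend linearly (or, for the positive part,
  1-Lipschitz) on \<open>u\<close>, and such integrals pass to the limit as soon as both factors converge in
  \<open>L\<^sup>2\<close> (\<open>tendsto_integral_mult_L2\<close>). For the leading term this convergence is the hypothesis itself;
  for the others it reduces to convergence of \<open>u\<close> in \<open>L\<^sup>2(\<Omega>)\<close>, which is supplied by a Poincare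
  inequality for the truncated kernel \<open>k\<close> (\<open>poincare_inequality\<close>).

  That inequality is proved by translations: a function vanishing outside a bounded set is the
  telescoping sum of its increments along \<open>n\<close> steps of size \<open>h\<close> that lead out of the set, and
  averaging over \<open>1/2 < \<bar>h\<bar> < 1\<close>, where \<open>k \<ge> 1\<close>, replaces the translation differences by the
  energy.
\<close>

section \<open>Products of square-integrable functions\<close>

lemma integral_mult_Cauchy_Schwarz:
  fixes f g :: "'b \<Rightarrow> real"
  assumes [measurable]: "f \<in> borel_measurable M" "g \<in> borel_measurable M"
    and f: "integrable M (\<lambda>x. (f x)\<^sup>2)" and g: "integrable M (\<lambda>x. (g x)\<^sup>2)"
  shows "integrable M (\<lambda>x. f x * g x)"
    and "\<bar>\<integral>x. f x * g x \<partial>M\<bar> \<le> sqrt (\<integral>x. (f x)\<^sup>2 \<partial>M) * sqrt (\<integral>x. (g x)\<^sup>2 \<partial>M)"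
proof -
  have bound: "\<bar>a * b\<bar> \<le> a\<^sup>2 + b\<^sup>2" for a b :: real
    using sum_squares_bound[of "\<bar>a\<bar>" "\<bar>b\<bar>"] mult_nonneg_nonneg[of "\<bar>a\<bar>" "\<bar>b\<bar>"]
    unfolding abs_mult power2_abs by linarith
  show int: "integrable M (\<lambda>x. f x * g x)"
    by (rule Bochner_Integration.integrable_bound[OF Bochner_Integration.integrable_add[OF f g]])
       (use bound in auto)
  let ?A = "\<integral>x. \<bar>f x * g x\<bar> \<partial>M"
  have A: "(\<integral>\<^sup>+x. ennreal \<bar>f x\<bar> * ennreal \<bar>g x\<bar> \<partial>M) = ennreal ?A"
    using nn_integral_eq_integral[OF integrable_abs[OF int]] by (simp add: abs_mult ennreal_mult)
  have sq: "ennreal \<bar>h x\<bar> ^ 2 = ennreal ((h x)\<^sup>2)" for h :: "'b \<Rightarrow> real" and x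
    by (simp add: ennreal_power)
  have "(ennreal ?A)\<^sup>2 \<le> ennreal (\<integral>x. (f x)\<^sup>2 \<partial>M) * ennreal (\<integral>x. (g x)\<^sup>2 \<partial>M)"
    using Cauchy_Schwarz_nn_integral[of "\<lambda>x. ennreal \<bar>f x\<bar>" M "\<lambda>x. ennreal \<bar>g x\<bar>"]
    unfolding A sq by (simp add: nn_integral_eq_integral f g)
  then have "?A\<^sup>2 \<le> (\<integral>x. (f x)\<^sup>2 \<partial>M) * (\<integral>x. (g x)\<^sup>2 \<partial>M)"
    by (simp add: ennreal_power ennreal_mult[symmetric])
  then have "?A \<le> sqrt (\<integral>x. (f x)\<^sup>2 \<partial>M) * sqrt (\<integral>x. (g x)\<^sup>2 \<partial>M)"
    unfolding real_sqrt_mult[symmetric] by (rule real_le_rsqrt)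
  then show "\<bar>\<integral>x. f x * g x \<partial>M\<bar> \<le> sqrt (\<integral>x. (f x)\<^sup>2 \<partial>M) * sqrt (\<integral>x. (g x)\<^sup>2 \<partial>M)"
    using integral_abs_bound[of M "\<lambda>x. f x * g x"] by linarith
qed

lemma integrable_diff_squared:
  fixes f g :: "'b \<Rightarrow> real"
  assumes [measurable]: "f \<in> borel_measurable M" "g \<in> borel_measurable M"
    and f: "integrable M (\<lambda>x. (f x)\<^sup>2)" and g: "integrable M (\<lambda>x. (g x)\<^sup>2)"
  shows "integrable M (\<lambda>x. (f x - g x)\<^sup>2)"
  using f g integral_mult_Cauchy_Schwarz(1)[OF assms] by (simp add: power2_diff mult.assoc)

text \<open>
  With equal factors this gives continuity of the squared norm; with different ones it treats the form with kernel \<open>j\<close>, which is not positive.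
  The proof expands \<open>f\<^sub>s g\<^sub>s - f g\<close> into \<open>D E + f E + D g\<close> with \<open>D = f\<^sub>s - f\<close>, \<open>E = g\<^sub>s - g\<close>.
  The set \<open>S\<close> of indices allows nets that are well behaved only eventually, such as
  \<open>at t within S\<close>.
\<close>

lemma tendsto_integral_mult_L2:
  fixes f g :: "'b \<Rightarrow> real" and fs gs :: "'i \<Rightarrow> 'b \<Rightarrow> real"
  assumes meas [measurable]: "f \<in> borel_measurable M" "g \<in> borel_measurable M"
      "\<And>s. s \<in> S \<Longrightarrow> fs s \<in> borel_measurable M" "\<And>s. s \<in> S \<Longrightarrow> gs s \<in> borel_measurable M"
    and f: "integrable M (\<lambda>x. (f x)\<^sup>2)" and g: "integrable M (\<lambda>x. (g x)\<^sup>2)"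
    and fs: "\<And>s. s \<in> S \<Longrightarrow> integrable M (\<lambda>x. (fs s x)\<^sup>2)"
    and gs: "\<And>s. s \<in> S \<Longrightarrow> integrable M (\<lambda>x. (gs s x)\<^sup>2)"
    and S: "eventually (\<lambda>s. s \<in> S) F"
    and f_lim: "((\<lambda>s. \<integral>x. (fs s x - f x)\<^sup>2 \<partial>M) \<longlongrightarrow> 0) F"
    and g_lim: "((\<lambda>s. \<integral>x. (gs s x - g x)\<^sup>2 \<partial>M) \<longlongrightarrow> 0) F"
  shows "((\<lambda>s. \<integral>x. fs s x * gs s x \<partial>M) \<longlongrightarrow> (\<integral>x. f x * g x \<partial>M)) F"
proof (rule Lim_transform2[OF tendsto_const])
  let ?d = "\<lambda>s. sqrt (\<integral>x. (fs s x - f x)\<^sup>2 \<partial>M)" and ?e = "\<lambda>s. sqrt (\<integral>x. (gs s x - g x)\<^sup>2 \<partial>M)"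
  let ?f = "sqrt (\<integral>x. (f x)\<^sup>2 \<partial>M)" and ?g = "sqrt (\<integral>x. (g x)\<^sup>2 \<partial>M)"
  have "((\<lambda>s. ?d s * ?e s + ?f * ?e s + ?d s * ?g) \<longlongrightarrow> 0) F"
    by (rule tendsto_eq_intros f_lim g_lim refl | simp)+
  then show "((\<lambda>s. (\<integral>x. f x * g x \<partial>M) - (\<integral>x. fs s x * gs s x \<partial>M)) \<longlongrightarrow> 0) F"
  proof (rule Lim_null_comparison[rotated])
    show "\<forall>\<^sub>F s in F. norm ((\<integral>x. f x * g x \<partial>M) - (\<integral>x. fs s x * gs s x \<partial>M))
        \<le> ?d s * ?e s + ?f * ?e s + ?d s * ?g"
      using S
    proof eventually_elim
      case (elim s)
      note [measurable] = meas(3,4)[OF elim]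
      let ?D = "\<lambda>x. fs s x - f x" and ?E = "\<lambda>x. gs s x - g x"
      have D: "integrable M (\<lambda>x. (?D x)\<^sup>2)" and E: "integrable M (\<lambda>x. (?E x)\<^sup>2)"
        using f g fs[OF elim] gs[OF elim] by (auto intro!: integrable_diff_squared)
      have DE: "integrable M (\<lambda>x. ?D x * ?E x)" "\<bar>\<integral>x. ?D x * ?E x \<partial>M\<bar> \<le> ?d s * ?e s"
        by (rule integral_mult_Cauchy_Schwarz; use D E in measurable)+
      have fE: "integrable M (\<lambda>x. f x * ?E x)" "\<bar>\<integral>x. f x * ?E x \<partial>M\<bar> \<le> ?f * ?e s"
        by (rule integral_mult_Cauchy_Schwarz; use f E in measurable)+
      have Dg: "integrable M (\<lambda>x. ?D x * g x)" "\<bar>\<integral>x. ?D x * g x \<partial>M\<bar> \<le> ?d s * ?g"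
        by (rule integral_mult_Cauchy_Schwarz; use g D in measurable)+
      have fg: "integrable M (\<lambda>x. f x * g x)"
        by (rule integral_mult_Cauchy_Schwarz; use f g in measurable)
      have "(\<integral>x. fs s x * gs s x \<partial>M)
          = (\<integral>x. f x * g x + ?D x * ?E x + f x * ?E x + ?D x * g x \<partial>M)"
        by (rule Bochner_Integration.integral_cong) (auto simp: algebra_simps)
      also have "\<dots> = (\<integral>x. f x * g x \<partial>M) + (\<integral>x. ?D x * ?E x \<partial>M) + (\<integral>x. f x * ?E x \<partial>M)
          + (\<integral>x. ?D x * g x \<partial>M)"
        by (simp only: Bochner_Integration.integral_add Bochner_Integration.integrable_add DE fE Dg fg)
      finally show ?case using DE(2) fE(2) Dg(2) by (simp only: real_norm_def)
    qed
  qed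
qed

section \<open>Functions of bounded support and their translates\<close>

lemma nn_integral_lborel_translate:
  fixes f :: "'a::euclidean_space \<Rightarrow> ennreal"
  assumes [measurable]: "f \<in> borel_measurable borel"
  shows "(\<integral>\<^sup>+x. f (x + a) \<partial>lborel) = (\<integral>\<^sup>+x. f x \<partial>lborel)"
proof -
  have "(\<integral>\<^sup>+x. f x \<partial>lborel) = (\<integral>\<^sup>+x. f x \<partial>distr lborel borel ((+) a))"
    by (simp add: lborel_distr_plus)
  also have "\<dots> = (\<integral>\<^sup>+x. f (x + a) \<partial>lborel)"
    by (subst nn_integral_distr) (auto simp: add.commute)
  finally show ?thesis ..
qed

lemma square_le_sum_increments:
  fixes a :: "nat \<Rightarrow> real"
  assumes "a n = 0"
  shows "(a 0)\<^sup>2 \<le> real n * (\<Sum>i<n. (a i - a (Suc i))\<^sup>2)"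
proof -
  have "a 0 = (\<Sum>i<n. 1 * (a i - a (Suc i)))"
    using assms by (simp add: sum_lessThan_telescope')
  then show ?thesis
    using Cauchy_Schwarz_ineq_sum[of "\<lambda>i. 1" "\<lambda>i. a i - a (Suc i)" "{..<n}"] by simp
qed

text \<open>
  After \<open>n\<close> steps of size \<open>h\<close> every point of \<open>\<Omega>\<close> has left \<open>\<Omega>\<close>, so \<open>u x\<close> is the sum of \<open>n\<close> increments.
  One factor \<open>n\<close> comes from the Cauchy--Schwarz inequality for that sum, the other from the \<open>n\<close>
  increments, all of which have the same integral by translation invariance.
\<close>

lemma norm_square_le_translation_difference:
  fixes u :: "'a::euclidean_space \<Rightarrow> real"
  assumes [measurable]: "u \<in> borel_measurable borel"
    and supp: "\<And>x. x \<notin> \<Omega> \<Longrightarrow> u x = 0"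
    and diam: "\<And>x y. x \<in> \<Omega> \<Longrightarrow> y \<in> \<Omega> \<Longrightarrow> dist x y < real n * norm h"
  shows "(\<integral>\<^sup>+x. ennreal ((u x)\<^sup>2) \<partial>lborel)
    \<le> ennreal (real n ^ 2) * (\<integral>\<^sup>+x. ennreal ((u x - u (x + h))\<^sup>2) \<partial>lborel)"
proof -
  let ?I = "\<integral>\<^sup>+x. ennreal ((u x - u (x + h))\<^sup>2) \<partial>lborel"
  let ?a = "\<lambda>x i. u (x + real i *\<^sub>R h)"
  have step: "?a x (Suc i) = u (x + real i *\<^sub>R h + h)" for x i
    by (simp add: algebra_simps)
  have "(u x)\<^sup>2 \<le> real n * (\<Sum>i<n. (?a x i - ?a x (Suc i))\<^sup>2)" for x
  proof (cases "x \<in> \<Omega>")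
    case True
    have "x + real n *\<^sub>R h \<notin> \<Omega>"
      using diam[OF True, of "x + real n *\<^sub>R h"] by (auto simp: dist_norm)
    then show ?thesis
      using square_le_sum_increments[of "?a x" n] supp by simp
  qed (auto simp: supp intro!: mult_nonneg_nonneg sum_nonneg)
  then have "(\<integral>\<^sup>+x. ennreal ((u x)\<^sup>2) \<partial>lborel)
      \<le> (\<integral>\<^sup>+x. ennreal (real n) * (\<Sum>i<n. ennreal ((?a x i - ?a x (Suc i))\<^sup>2)) \<partial>lborel)"
    by (intro nn_integral_mono) (simp add: ennreal_mult[symmetric] sum_nonneg ennreal_leI)
  also have "\<dots> = ennreal (real n) *
      (\<Sum>i<n. \<integral>\<^sup>+x. ennreal ((u (x + real i *\<^sub>R h) - u (x + real i *\<^sub>R h + h))\<^sup>2) \<partial>lborel)"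
    unfolding step by (subst nn_integral_cmult, measurable) (subst nn_integral_sum, auto)
  also have "\<dots> = ennreal (real n) * (\<Sum>i<n. ?I)"
    using nn_integral_lborel_translate[of "\<lambda>x. ennreal ((u x - u (x + h))\<^sup>2)"] by simp
  also have "\<dots> = ennreal (real n ^ 2) * ?I"
    by (simp add: power2_eq_square ennreal_mult mult.assoc ennreal_of_nat_eq_real_of_nat)
  finally show ?thesis .
qed

section \<open>The energy space and its Poincare inequality\<close>

lemma measurable_kernels [measurable]:
  "k_kernel \<in> borel_measurable borel" "j_kernel \<in> borel_measurable borel"
  unfolding k_kernel_def[abs_def] j_kernel_def[abs_def]
  by (intro borel_measurable_times borel_measurable_indicator borel_measurable_inverse
      borel_measurable_power borel_measurable_norm measurable_ident_sets borel_comp; simp)+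

lemma k_kernel_nonneg: "0 \<le> k_kernel z"
  by (simp add: k_kernel_def indicator_def)

lemma k_kernel_ge_one: "z \<noteq> 0 \<Longrightarrow> norm z < 1 \<Longrightarrow> 1 \<le> k_kernel z"
  by (simp add: k_kernel_def one_le_inverse power_le_one)

lemma k_kernel_minus: "k_kernel (- z) = k_kernel z"
  by (simp add: k_kernel_def indicator_def)

lemma j_kernel_bounds: "0 \<le> j_kernel z" "j_kernel z \<le> 1"
proof -
  show "0 \<le> j_kernel z" by (simp add: j_kernel_def)
  show "j_kernel z \<le> 1"
    by (auto simp: j_kernel_def indicator_def one_le_power inverse_le_1_iff)
qed

lemma c_const_pos: "0 < n \<Longrightarrow> 0 < c_const n"
  by (simp add: c_const_def Gamma_real_pos)

text \<open>
  The energy integrand is written as the square of \<open>(u x - u y) \<surd>k(x - y)\<close>: in this way the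
  energy becomes a squared \<open>L\<^sup>2\<close> norm, over pairs of points, of a quantity linear in \<open>u\<close>.
\<close>

lemma HH_D:
  assumes "u \<in> HH \<Omega>"
  shows "u \<in> borel_measurable borel" "\<And>x. x \<notin> \<Omega> \<Longrightarrow> u x = 0" "integrable lborel (\<lambda>x. (u x)\<^sup>2)"
    "integrable lborel (\<lambda>p. ((u (fst p) - u (snd p)) * sqrt (k_kernel (fst p - snd p)))\<^sup>2)"
  using assms by (auto simp: HH_def power_mult_distrib k_kernel_nonneg case_prod_unfold)

lemma EE_eq_L2:
  fixes u :: "'a::euclidean_space \<Rightarrow> real"
  shows "EE u u = c_const DIM('a) / 2 *
    (\<integral>p. ((u (fst p) - u (snd p)) * sqrt (k_kernel (fst p - snd p)))\<^sup>2 \<partial>lborel)"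
  unfolding EE_def power_mult_distrib power2_eq_square[symmetric]
  by (simp add: k_kernel_nonneg case_prod_unfold)

lemma HH_norm_square:
  fixes u :: "'a::euclidean_space \<Rightarrow> real"
  shows "(HH_norm u)\<^sup>2 = c_const DIM('a) / 2 *
    (\<integral>p. ((u (fst p) - u (snd p)) * sqrt (k_kernel (fst p - snd p)))\<^sup>2 \<partial>lborel)"
  using c_const_pos[of "DIM('a)"] by (simp add: HH_norm_def EE_eq_L2)

lemma HH_diff:
  fixes u :: "'a::euclidean_space \<Rightarrow> real"
  assumes u: "u \<in> HH \<Omega>" and v: "v \<in> HH \<Omega>"
  shows "(\<lambda>x. u x - v x) \<in> HH \<Omega>"
proof -
  note [measurable] = HH_D(1)[OF u] HH_D(1)[OF v]
  have "integrable lborel (\<lambda>p :: 'a \<times> 'a.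
      ((u (fst p) - u (snd p)) * sqrt (k_kernel (fst p - snd p))
       - (v (fst p) - v (snd p)) * sqrt (k_kernel (fst p - snd p)))\<^sup>2)"
    by (rule integrable_diff_squared) (use HH_D(4)[OF u] HH_D(4)[OF v] in \<open>auto simp flip: lborel_prod\<close>)
  also have "(\<lambda>p. ((u (fst p) - u (snd p)) * sqrt (k_kernel (fst p - snd p))
       - (v (fst p) - v (snd p)) * sqrt (k_kernel (fst p - snd p)))\<^sup>2)
     = (\<lambda>p. (\<bar>(u (fst p) - v (fst p)) - (u (snd p) - v (snd p))\<bar>\<^sup>2 * k_kernel (fst p - snd p)))"
    unfolding left_diff_distrib[symmetric] power_mult_distrib
    by (simp add: k_kernel_nonneg algebra_simps)
  finally show ?thesis
    using HH_D(2)[OF u] HH_D(2)[OF v] integrable_diff_squared[OF _ _ HH_D(3)[OF u] HH_D(3)[OF v]]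
    by (simp add: HH_def case_prod_unfold)
qed

text \<open>
  This makes the seminorm of \<open>\<H>(\<Omega>)\<close> control the \<open>L\<^sup>2\<close> norm, although \<open>k\<close> only sees points at
  distance less than \<open>1\<close> while \<open>\<Omega>\<close> may be much larger. Steps \<open>h\<close> are taken from the shell
  \<open>1/2 < \<bar>h\<bar> < 1\<close>: there \<open>k h \<ge> 1\<close>, and a number of steps depending only on the diameter suffices for
  all of them.
\<close>

lemma poincare_inequality:
  fixes \<Omega> :: "'a::euclidean_space set"
  assumes "bounded \<Omega>"
  obtains C where "\<And>u. u \<in> HH \<Omega> \<Longrightarrow> (\<integral>x. (u x)\<^sup>2 \<partial>lborel) \<le> C * (HH_norm u)\<^sup>2"
proof -
  let ?A = "ball 0 1 - cball 0 (1/2) :: 'a set"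
  obtain n :: nat where n: "2 * diameter \<Omega> < real n"
    using reals_Archimedean2 by blast
  define m where "m = measure lborel ?A"
  have A_fin: "emeasure lborel ?A = ennreal m"
    unfolding m_def by (intro emeasure_eq_ennreal_measure) (use emeasure_bounded_finite[of ?A] bounded_subset[OF bounded_ball] in \<open>auto simp: less_top\<close>)
  obtain b :: 'a where b: "b \<in> Basis" using nonempty_Basis by blast
  have "emeasure lborel ?A \<noteq> 0"
  proof
    assume "emeasure lborel ?A = 0"
    moreover have "open ?A" by (simp add: open_Diff)
    ultimately have "?A = {}"
      using open_not_negligible[of ?A]
      by (auto simp: negligible_iff_null_sets null_sets_def intro: null_sets_completionI)
    moreover have "(3/4) *\<^sub>R b \<in> ?A" using b by simp
    ultimately show False by blast
  qed
  then have m: "m > 0" using A_fin by (metis ennreal_0 m_def measure_nonneg order_le_less)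
  have key: "m * (\<integral>x. (u x)\<^sup>2 \<partial>lborel)
      \<le> real n ^ 2 * (\<integral>p. ((u (fst p) - u (snd p)) * sqrt (k_kernel (fst p - snd p)))\<^sup>2 \<partial>lborel)"
    if u: "u \<in> HH \<Omega>" for u
  proof -
    note [measurable] = HH_D(1)[OF u]
    let ?N = "\<integral>\<^sup>+x. ennreal ((u x)\<^sup>2) \<partial>lborel"
    let ?w = "\<lambda>x h. ennreal ((u x - u (x + h))\<^sup>2)"
    \<comment> \<open>Integrating this bound over \<open>h\<close> and substituting \<open>y = x + h\<close> turns the right side into the energy.\<close>
    have pt: "indicator ?A h * ?N \<le> ennreal (real n ^ 2) * (\<integral>\<^sup>+x. ?w x h * k_kernel h \<partial>lborel)" for h
    proof (cases "h \<in> ?A")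
      case True
      have "dist x y < real n * norm h" if "x \<in> \<Omega>" "y \<in> \<Omega>" for x y
      proof -
        have "dist x y \<le> diameter \<Omega>" using diameter_bounded_bound[OF assms that] .
        also have "\<dots> < real n * (1/2)" using n by simp
        also have "\<dots> \<le> real n * norm h" using True by (intro mult_left_mono) auto
        finally show ?thesis .
      qed
      then have "?N \<le> ennreal (real n ^ 2) * (\<integral>\<^sup>+x. ?w x h \<partial>lborel)"
        by (intro norm_square_le_translation_difference[where \<Omega> = \<Omega>] HH_D[OF u])
      also have "\<dots> \<le> ennreal (real n ^ 2) * (\<integral>\<^sup>+x. ?w x h * k_kernel h \<partial>lborel)"
      proof (intro mult_left_mono nn_integral_mono)
        have "1 \<le> ennreal (k_kernel h)" using True by (auto intro!: k_kernel_ge_one)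
        then show "?w x h \<le> ?w x h * k_kernel h" for x
          using mult_left_mono[of 1 "ennreal (k_kernel h)" "?w x h"] by simp
      qed simp
      finally show ?thesis using True by simp
    qed simp
    have "ennreal m * ?N = (\<integral>\<^sup>+h. indicator ?A h * ?N \<partial>lborel)"
      using A_fin by (subst nn_integral_multc) (auto intro!: borel_measurable_indicator)
    also have "\<dots> \<le> (\<integral>\<^sup>+h. ennreal (real n ^ 2) * (\<integral>\<^sup>+x. ?w x h * k_kernel h \<partial>lborel) \<partial>lborel)"
      using pt by (intro nn_integral_mono)
    also have "\<dots> = ennreal (real n ^ 2) * (\<integral>\<^sup>+h. \<integral>\<^sup>+x. ?w x h * k_kernel h \<partial>lborel \<partial>lborel)"
      by (rule nn_integral_cmult) measurable
    also have "(\<integral>\<^sup>+h. \<integral>\<^sup>+x. ?w x h * k_kernel h \<partial>lborel \<partial>lborel)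
        = (\<integral>\<^sup>+x. \<integral>\<^sup>+h. ?w x h * k_kernel h \<partial>lborel \<partial>lborel)"
      by (rule lborel_pair.Fubini') measurable
    also have "\<dots> = (\<integral>\<^sup>+x. \<integral>\<^sup>+y. ennreal ((u x - u y)\<^sup>2) * k_kernel (x - y) \<partial>lborel \<partial>lborel)"
    proof (rule nn_integral_cong)
      fix x
      have "?w x h * k_kernel h = (\<lambda>y. ennreal ((u x - u y)\<^sup>2) * k_kernel (x - y)) (h + x)" for h
        using k_kernel_minus[of h] by (simp add: add.commute)
      then show "(\<integral>\<^sup>+h. ?w x h * k_kernel h \<partial>lborel)
          = (\<integral>\<^sup>+y. ennreal ((u x - u y)\<^sup>2) * k_kernel (x - y) \<partial>lborel)"
        using nn_integral_lborel_translate[of "\<lambda>y. ennreal ((u x - u y)\<^sup>2) * k_kernel (x - y)" x]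
        by simp
    qed
    also have "\<dots> = (\<integral>\<^sup>+p. ennreal (((u (fst p) - u (snd p)) * sqrt (k_kernel (fst p - snd p)))\<^sup>2)
        \<partial>(lborel \<Otimes>\<^sub>M lborel))"
      by (subst lborel.nn_integral_fst[symmetric])
         (auto simp: power_mult_distrib k_kernel_nonneg ennreal_mult)
    also have "\<dots> = ennreal (\<integral>p. ((u (fst p) - u (snd p)) * sqrt (k_kernel (fst p - snd p)))\<^sup>2 \<partial>lborel)"
      unfolding lborel_prod by (rule nn_integral_eq_integral) (use HH_D(4)[OF u] in auto)
    also have "?N = ennreal (\<integral>x. (u x)\<^sup>2 \<partial>lborel)"
      by (rule nn_integral_eq_integral) (use HH_D(3)[OF u] in auto)
    finally show ?thesis
      using m by (simp add: ennreal_mult[symmetric])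
  qed
  have c: "c_const DIM('a) > 0" by (simp add: c_const_pos)
  show thesis
  proof (rule that)
    fix u assume u: "u \<in> HH \<Omega>"
    show "(\<integral>x. (u x)\<^sup>2 \<partial>lborel) \<le> real n ^ 2 * 2 / (m * c_const DIM('a)) * (HH_norm u)\<^sup>2"
      using key[OF u] m c unfolding HH_norm_square by (simp add: field_simps)
  qed
qed

section \<open>Continuity of the functional\<close>

lemma integral_tensor_product:
  fixes a :: "'a::euclidean_space \<Rightarrow> real" and b :: "'b::euclidean_space \<Rightarrow> real"
  assumes a: "integrable lborel a" and b: "integrable lborel b"
  shows "integrable lborel (\<lambda>p. a (fst p) * b (snd p))"
    and "(\<integral>p. a (fst p) * b (snd p) \<partial>lborel) = (\<integral>x. a x \<partial>lborel) * (\<integral>y. b y \<partial>lborel)"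
proof -
  note [measurable] = borel_measurable_integrable[OF a] borel_measurable_integrable[OF b]
  have int: "integrable (lborel \<Otimes>\<^sub>M lborel) (\<lambda>p. a (fst p) * b (snd p))"
    by (rule lborel_pair.Fubini_integrable) (use a b in \<open>auto simp: abs_mult\<close>)
  then show "integrable lborel (\<lambda>p. a (fst p) * b (snd p))"
    unfolding lborel_prod .
  show "(\<integral>p. a (fst p) * b (snd p) \<partial>lborel) = (\<integral>x. a x \<partial>lborel) * (\<integral>y. b y \<partial>lborel)"
    using lborel_pair.integral_fst'[OF int] by (simp add: lborel_prod)
qed

text \<open>
  Since \<open>j\<close> is not integrable over the whole space, the support of \<open>u\<close> has to be used: the integrand
  is split as \<open>(u x 1\<^sub>\<Omega> y) \<cdot> (u y 1\<^sub>\<Omega> x j(x - y))\<close>. As \<open>0 \<le> j \<le> 1\<close> and \<open>\<Omega>\<close> has finite measure, both factors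
  then have squared \<open>L\<^sup>2\<close> norm at most \<open>\<bar>\<Omega>\<bar> \<integral>u\<^sup>2\<close>, and applying this to differences gives the limit.
\<close>

lemma tendsto_j_integral:
  fixes u :: "'a::euclidean_space \<Rightarrow> real" and us :: "'i \<Rightarrow> 'a \<Rightarrow> real"
  assumes [measurable]: "\<Omega> \<in> sets borel" and bdd: "bounded \<Omega>"
    and u: "u \<in> HH \<Omega>" and us: "\<And>s. s \<in> S \<Longrightarrow> us s \<in> HH \<Omega>" and S: "eventually (\<lambda>s. s \<in> S) F"
    and lim: "((\<lambda>s. \<integral>x. (us s x - u x)\<^sup>2 \<partial>lborel) \<longlongrightarrow> 0) F"
  shows "((\<lambda>s. \<integral>(x :: 'a, y). us s x * us s y * j_kernel (x - y) \<partial>lborel)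
    \<longlongrightarrow> (\<integral>(x :: 'a, y). u x * u y * j_kernel (x - y) \<partial>lborel)) F"
proof -
  define f :: "('a \<Rightarrow> real) \<Rightarrow> 'a \<times> 'a \<Rightarrow> real"
    where "f v p = v (fst p) * indicator \<Omega> (snd p)" for v p
  define g :: "('a \<Rightarrow> real) \<Rightarrow> 'a \<times> 'a \<Rightarrow> real"
    where "g v p = v (snd p) * indicator \<Omega> (fst p) * j_kernel (fst p - snd p)" for v p
  have ind: "integrable lborel (indicator \<Omega> :: 'a \<Rightarrow> real)"
    using emeasure_bounded_finite[OF bdd] by (auto simp: integrable_indicator_iff)
  have f_meas: "f v \<in> borel_measurable lborel" and g_meas: "g v \<in> borel_measurable lborel"
    if v: "v \<in> HH \<Omega>" for v
  proof -
    note [measurable] = HH_D(1)[OF v]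
    show "f v \<in> borel_measurable lborel" "g v \<in> borel_measurable lborel"
      unfolding lborel_prod[symmetric] f_def[abs_def] g_def[abs_def] by measurable
  qed
  have f_sq: "(f v p)\<^sup>2 = (v (fst p))\<^sup>2 * indicator \<Omega> (snd p)" for v p
    by (simp add: f_def indicator_def)
  have g_sq: "(g v p)\<^sup>2 \<le> indicator \<Omega> (fst p) * (v (snd p))\<^sup>2" for v p
    using mult_left_le[OF power_le_one[OF j_kernel_bounds], of "(v (snd p))\<^sup>2" "fst p - snd p" 2]
    by (simp add: g_def indicator_def power_mult_distrib)
  have f_int: "integrable lborel (\<lambda>p. (f v p)\<^sup>2)"
    and f_eq: "(\<integral>p. (f v p)\<^sup>2 \<partial>lborel) = (\<integral>x. (v x)\<^sup>2 \<partial>lborel) * measure lborel \<Omega>"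
    and g_int: "integrable lborel (\<lambda>p. (g v p)\<^sup>2)"
    and g_le: "(\<integral>p. (g v p)\<^sup>2 \<partial>lborel) \<le> measure lborel \<Omega> * (\<integral>x. (v x)\<^sup>2 \<partial>lborel)"
    if v: "v \<in> HH \<Omega>" for v
  proof -
    show "integrable lborel (\<lambda>p. (f v p)\<^sup>2)"
      "(\<integral>p. (f v p)\<^sup>2 \<partial>lborel) = (\<integral>x. (v x)\<^sup>2 \<partial>lborel) * measure lborel \<Omega>"
      unfolding f_sq using integral_tensor_product[OF HH_D(3)[OF v] ind] by simp_all
    have prod: "integrable lborel (\<lambda>p. indicator \<Omega> (fst p) * (v (snd p))\<^sup>2)"
      "(\<integral>p. indicator \<Omega> (fst p) * (v (snd p))\<^sup>2 \<partial>lborel) = measure lborel \<Omega> * (\<integral>x. (v x)\<^sup>2 \<partial>lborel)"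
      using integral_tensor_product[OF ind HH_D(3)[OF v]] by simp_all
    show int: "integrable lborel (\<lambda>p. (g v p)\<^sup>2)"
      by (rule Bochner_Integration.integrable_bound[OF prod(1)])
         (use g_sq g_meas[OF v] in \<open>auto intro!: borel_measurable_power\<close>)
    show "(\<integral>p. (g v p)\<^sup>2 \<partial>lborel) \<le> measure lborel \<Omega> * (\<integral>x. (v x)\<^sup>2 \<partial>lborel)"
      unfolding prod(2)[symmetric] by (intro integral_mono int prod g_sq)
  qed
  have fg: "f v p * g v p = (case p of (x, y) \<Rightarrow> v x * v y * j_kernel (x - y))"
    if v: "v \<in> HH \<Omega>" for v p
    using HH_D(2)[OF v] by (cases p) (auto simp: f_def g_def indicator_def)
  have f_diff: "f v p - f w p = f (\<lambda>x. v x - w x) p" and g_diff: "g v p - g w p = g (\<lambda>x. v x - w x) p"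
    for v w p by (simp_all add: f_def g_def algebra_simps)
  have "((\<lambda>s. \<integral>p. f (us s) p * g (us s) p \<partial>lborel) \<longlongrightarrow> (\<integral>p. f u p * g u p \<partial>lborel)) F"
  proof (rule tendsto_integral_mult_L2[where S = S])
    have lim': "((\<lambda>s. (\<integral>x. (us s x - u x)\<^sup>2 \<partial>lborel) * measure lborel \<Omega>) \<longlongrightarrow> 0) F"
      using tendsto_mult_right[OF lim, of "measure lborel \<Omega>"] by simp
    show "((\<lambda>s. \<integral>p. (f (us s) p - f u p)\<^sup>2 \<partial>lborel) \<longlongrightarrow> 0) F"
      by (rule Lim_null_comparison[OF eventually_mono[OF S] lim'])
         (simp add: f_diff f_eq HH_diff u us)
    show "((\<lambda>s. \<integral>p. (g (us s) p - g u p)\<^sup>2 \<partial>lborel) \<longlongrightarrow> 0) F"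
      by (rule Lim_null_comparison[OF eventually_mono[OF S] lim'])
         (use g_le[OF HH_diff[OF us u]] in \<open>simp add: g_diff mult.commute\<close>)
  qed (use f_meas g_meas in \<open>auto intro: f_int g_int u us S\<close>)
  then have "((\<lambda>s. \<integral>p. f (us s) p * g (us s) p \<partial>lborel)
      \<longlongrightarrow> (\<integral>(x, y). u x * u y * j_kernel (x - y) \<partial>lborel)) F"
    unfolding fg[OF u] .
  then show ?thesis
    by (rule tendsto_cong[THEN iffD1, rotated])
       (rule eventually_mono[OF S], simp add: fg us)
qed

lemma set_integral_positive_part:
  assumes "u \<in> HH \<Omega>"
  shows "(LINT x:\<Omega>|lborel. (max (u x) 0)\<^sup>2) = (\<integral>x. (max (u x) 0)\<^sup>2 \<partial>lborel)"
  unfolding set_lebesgue_integral_def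
  by (rule Bochner_Integration.integral_cong) (use HH_D(2)[OF assms] in \<open>auto simp: indicator_def\<close>)

lemma tendsto_E_r:
  fixes u :: "'a::euclidean_space \<Rightarrow> real" and us :: "'i \<Rightarrow> 'a \<Rightarrow> real"
  assumes \<Omega>: "\<Omega> \<in> sets borel" "bounded \<Omega>"
    and u: "u \<in> HH \<Omega>" and us: "\<And>s. s \<in> S \<Longrightarrow> us s \<in> HH \<Omega>" and S: "eventually (\<lambda>s. s \<in> S) F"
    and lim: "((\<lambda>s. HH_norm (\<lambda>x. us s x - u x)) \<longlongrightarrow> 0) F"
  shows "((\<lambda>s. E_r \<Omega> r (us s)) \<longlongrightarrow> E_r \<Omega> r u) F"
proof -
  note meas = HH_D(1)[OF u] HH_D(1)[OF us]
  have lim2: "((\<lambda>s. (HH_norm (\<lambda>x. us s x - u x))\<^sup>2) \<longlongrightarrow> 0) F"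
    using tendsto_power[OF lim, of 2] by simp
  obtain C where C: "\<And>u. u \<in> HH \<Omega> \<Longrightarrow> (\<integral>x. (u x)\<^sup>2 \<partial>lborel) \<le> C * (HH_norm u)\<^sup>2"
    using poincare_inequality[OF \<Omega>(2)] by blast
  have L2: "((\<lambda>s. \<integral>x. (us s x - u x)\<^sup>2 \<partial>lborel) \<longlongrightarrow> 0) F"
  proof (rule Lim_null_comparison)
    show "\<forall>\<^sub>F s in F. norm (\<integral>x. (us s x - u x)\<^sup>2 \<partial>lborel) \<le> C * (HH_norm (\<lambda>x. us s x - u x))\<^sup>2"
      using S by eventually_elim (use C[OF HH_diff[OF us u]] in simp)
    show "((\<lambda>s. C * (HH_norm (\<lambda>x. us s x - u x))\<^sup>2) \<longlongrightarrow> 0) F"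
      using tendsto_mult_left[OF lim2, of C] by simp
  qed
  have mass: "((\<lambda>s. \<integral>x. us s x * us s x \<partial>lborel) \<longlongrightarrow> (\<integral>x. u x * u x \<partial>lborel)) F"
    by (rule tendsto_integral_mult_L2[where S = S]) (use meas HH_D(3) u us S L2 in auto)
  have pos_int: "integrable lborel (\<lambda>x. (max (v x) 0)\<^sup>2)" if v: "v \<in> HH \<Omega>" for v
    by (rule Bochner_Integration.integrable_bound[OF HH_D(3)[OF v]])
       (use HH_D(1)[OF v] in \<open>auto simp: max_def\<close>)
  have pos_L2: "((\<lambda>s. \<integral>x. (max (us s x) 0 - max (u x) 0)\<^sup>2 \<partial>lborel) \<longlongrightarrow> 0) F"
  proof (rule Lim_null_comparison[OF _ L2])
    show "\<forall>\<^sub>F s in F. norm (\<integral>x. (max (us s x) 0 - max (u x) 0)\<^sup>2 \<partial>lborel)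
        \<le> (\<integral>x. (us s x - u x)\<^sup>2 \<partial>lborel)"
      using S
    proof eventually_elim
      case (elim s)
      note [measurable] = meas(1) meas(2)[OF elim]
      have "(max a 0 - max b 0)\<^sup>2 \<le> (a - b)\<^sup>2" for a b :: real
        by (rule abs_le_square_iff[THEN iffD1]) (auto simp: max_def)
      then have "(\<integral>x. (max (us s x) 0 - max (u x) 0)\<^sup>2 \<partial>lborel) \<le> (\<integral>x. (us s x - u x)\<^sup>2 \<partial>lborel)"
        by (intro integral_mono integrable_diff_squared pos_int HH_D(3)[OF u] HH_D(3)[OF us] u us elim) auto
      then show ?case by simp
    qed
  qed
  have "((\<lambda>s. \<integral>x. max (us s x) 0 * max (us s x) 0 \<partial>lborel)
      \<longlongrightarrow> (\<integral>x. max (u x) 0 * max (u x) 0 \<partial>lborel)) F"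
    by (rule tendsto_integral_mult_L2[where S = S])
       (use meas pos_int u us S pos_L2 in auto)
  then have "((\<lambda>s. \<integral>x. (max (us s x) 0)\<^sup>2 \<partial>lborel) \<longlongrightarrow> (\<integral>x. (max (u x) 0)\<^sup>2 \<partial>lborel)) F"
    unfolding power2_eq_square .
  then have pos: "((\<lambda>s. LINT x:\<Omega>|lborel. (max (us s x) 0)\<^sup>2)
      \<longlongrightarrow> (LINT x:\<Omega>|lborel. (max (u x) 0)\<^sup>2)) F"
    unfolding set_integral_positive_part[OF u]
    by (rule Lim_transform_eventually)
       (rule eventually_mono[OF S], simp add: set_integral_positive_part us)
  \<comment> \<open>The square of \<open>D v\<close> integrates to \<open>2/c\<^sub>N\<close> times the energy of \<open>v\<close>.\<close>
  define D :: "('a \<Rightarrow> real) \<Rightarrow> 'a \<times> 'a \<Rightarrow> real"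
    where "D v p = (v (fst p) - v (snd p)) * sqrt (k_kernel (fst p - snd p))" for v p
  have D_meas: "D v \<in> borel_measurable lborel" if v: "v \<in> HH \<Omega>" for v
  proof -
    note [measurable] = HH_D(1)[OF v]
    show ?thesis unfolding lborel_prod[symmetric] D_def[abs_def] by measurable
  qed
  have D_diff: "D v p - D w p = D (\<lambda>x. v x - w x) p" for v w p
    by (simp add: D_def algebra_simps)
  have D_int: "integrable lborel (\<lambda>p. (D v p)\<^sup>2)" if "v \<in> HH \<Omega>" for v
    using HH_D(4)[OF that] by (simp add: D_def)
  have c: "c_const DIM('a) > 0" by (simp add: c_const_pos)
  have D_L2: "((\<lambda>s. \<integral>p. (D (us s) p - D u p)\<^sup>2 \<partial>lborel) \<longlongrightarrow> 0) F"
  proof -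
    have "(\<integral>p. (D (us s) p - D u p)\<^sup>2 \<partial>lborel) = 2 / c_const DIM('a) * (HH_norm (\<lambda>x. us s x - u x))\<^sup>2" for s
      unfolding D_diff unfolding HH_norm_square D_def using c by simp
    then show ?thesis
      using tendsto_mult_left[OF lim2, of "2 / c_const DIM('a)"] by simp
  qed
  have "((\<lambda>s. \<integral>p. D (us s) p * D (us s) p \<partial>lborel) \<longlongrightarrow> (\<integral>p. D u p * D u p \<partial>lborel)) F"
    by (rule tendsto_integral_mult_L2[where S = S])
       (use D_meas D_int u us S D_L2 in auto)
  then have "((\<lambda>s. EE (us s) (us s)) \<longlongrightarrow> EE u u) F"
    unfolding EE_eq_L2 D_def power2_eq_square by (rule tendsto_mult_left)
  then show ?thesis
    unfolding E_r_def EL_def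
    by (intro tendsto_intros pos mass tendsto_j_integral[OF \<Omega> u us S L2])
qed

section \<open>The minimax level\<close>

text \<open>
  Once the maximum is known to be attained, the description by the greatest element can be
  replaced by an actual point of the path.
\<close>

lemma max_on_path:
  assumes \<Omega>: "\<Omega> \<in> sets borel" "bounded \<Omega>" and \<gamma>: "\<gamma> \<in> paths \<Omega> \<phi>"
  obtains t where "t \<in> {-1..1}"
    "(GREATEST m. m \<in> E_r \<Omega> r ` \<gamma> ` {-1..1}) = E_r \<Omega> r (\<gamma> t)"
    "\<And>s. s \<in> {-1..1} \<Longrightarrow> E_r \<Omega> r (\<gamma> s) \<le> E_r \<Omega> r (\<gamma> t)"
proof -
  have HH: "\<gamma> s \<in> HH \<Omega>" if "s \<in> {-1..1}" for s
    using \<gamma> that by (auto simp: paths_def PP_def)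
  have "continuous_on {-1..1} (\<lambda>t. E_r \<Omega> r (\<gamma> t))"
    unfolding continuous_on_def
  proof
    fix t :: real assume t: "t \<in> {-1..1}"
    show "((\<lambda>s. E_r \<Omega> r (\<gamma> s)) \<longlongrightarrow> E_r \<Omega> r (\<gamma> t)) (at t within {-1..1})"
    proof (rule tendsto_E_r[OF \<Omega> HH[OF t], where S = "{-1..1}"])
      show "\<forall>\<^sub>F s in at t within {-1..1}. s \<in> {-1..1}"
        by (simp add: eventually_at_filter)
      show "((\<lambda>s. HH_norm (\<lambda>x. \<gamma> s x - \<gamma> t x)) \<longlongrightarrow> 0) (at t within {-1..1})"
        using \<gamma> t by (auto simp: paths_def)
    qed (rule HH)
  qed
  then obtain t where t: "t \<in> {-1..1}" "\<And>s. s \<in> {-1..1} \<Longrightarrow> E_r \<Omega> r (\<gamma> s) \<le> E_r \<Omega> r (\<gamma> t)"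
    using continuous_attains_sup[of "{-1..1::real}" "\<lambda>t. E_r \<Omega> r (\<gamma> t)"] by auto
  show thesis
    by (rule that[OF t(1) _ t(2)]) (use t in \<open>auto intro!: Greatest_equality\<close>)
qed

lemma positive_part_mass_bounds:
  assumes u: "u \<in> PP \<Omega>"
  shows "0 \<le> (LINT x:\<Omega>|lborel. (max (u x) 0)\<^sup>2)" "(LINT x:\<Omega>|lborel. (max (u x) 0)\<^sup>2) \<le> 1"
proof -
  have H: "u \<in> HH \<Omega>" using u by (simp add: PP_def)
  show "0 \<le> (LINT x:\<Omega>|lborel. (max (u x) 0)\<^sup>2)"
    unfolding set_integral_positive_part[OF H] by (rule Bochner_Integration.integral_nonneg) simp
  have "(LINT x:\<Omega>|lborel. (u x)\<^sup>2) = (\<integral>x. (u x)\<^sup>2 \<partial>lborel)"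
    unfolding set_lebesgue_integral_def
    by (rule Bochner_Integration.integral_cong) (use HH_D(2)[OF H] in \<open>auto simp: indicator_def\<close>)
  moreover have "(\<integral>x. (max (u x) 0)\<^sup>2 \<partial>lborel) \<le> (\<integral>x. (u x)\<^sup>2 \<partial>lborel)"
    by (rule integral_mono_AE') (use HH_D(3)[OF H] in \<open>auto simp: max_def\<close>)
  ultimately show "(LINT x:\<Omega>|lborel. (max (u x) 0)\<^sup>2) \<le> 1"
    using u unfolding set_integral_positive_part[OF H] by (simp add: PP_def)
qed

text \<open>
  Both follow from \<open>E\<^sub>r u - E\<^sub>r\<^sub>' u = (r' - r) \<integral>(u\<^sup>+)\<^sup>2\<close>, where the integral lies in \<open>[0, 1]\<close>.
\<close>

lemma E_r_change_parameter:
  assumes "u \<in> PP \<Omega>" "r \<le> r'"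
  shows "E_r \<Omega> r' u \<le> E_r \<Omega> r u" "E_r \<Omega> r u \<le> E_r \<Omega> r' u + (r' - r)"
proof -
  let ?p = "LINT x:\<Omega>|lborel. (max (u x) 0)\<^sup>2"
  have "0 \<le> (r' - r) * ?p" "(r' - r) * ?p \<le> r' - r"
    using positive_part_mass_bounds[OF assms(1)] assms(2) by (simp_all add: mult_left_le)
  then show "E_r \<Omega> r' u \<le> E_r \<Omega> r u" "E_r \<Omega> r u \<le> E_r \<Omega> r' u + (r' - r)"
    by (simp_all add: E_r_def algebra_simps)
qed

theorem proposition5p1:
  fixes \<Omega> :: "'a::euclidean_space set" and \<phi>1 :: "'a \<Rightarrow> real"
  assumes "open \<Omega>" "connected \<Omega>" "\<Omega> \<noteq> {}" "bounded \<Omega>" "C11_boundary \<Omega>"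
    and "first_eigenfunction \<Omega> \<phi>1"
  shows "antimono_on {0..} (c_level \<Omega> \<phi>1) \<and> (\<exists>L. L-lipschitz_on {0..} (c_level \<Omega> \<phi>1))"
proof (cases "paths \<Omega> \<phi>1 = {}")
  \<comment> \<open>The infimum of the empty set has no meaning here, but it does not depend on \<open>r\<close>.\<close>
  case True
  then have const: "c_level \<Omega> \<phi>1 r = Inf {}" for r
    by (simp add: c_level_def)
  have "0-lipschitz_on {0..} (c_level \<Omega> \<phi>1)"
    by (auto simp: lipschitz_on_def const)
  then show ?thesis by (auto simp: monotone_on_def const)
next
  case False
  let ?M = "\<lambda>r \<gamma>. GREATEST m. m \<in> E_r \<Omega> r ` \<gamma> ` {-1..1}"
  have \<Omega>: "\<Omega> \<in> sets borel" using assms(1) by simp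
  have PP: "\<gamma> t \<in> PP \<Omega>" if "\<gamma> \<in> paths \<Omega> \<phi>1" "t \<in> {-1..1}" for \<gamma> t
    using that by (auto simp: paths_def)
  have max: "?M r' \<gamma> \<le> ?M r \<gamma>" "?M r \<gamma> \<le> ?M r' \<gamma> + (r' - r)"
    if \<gamma>: "\<gamma> \<in> paths \<Omega> \<phi>1" and "r \<le> r'" for \<gamma> r r'
  proof -
    obtain t where t: "t \<in> {-1..1}" "?M r \<gamma> = E_r \<Omega> r (\<gamma> t)"
      "\<And>s. s \<in> {-1..1} \<Longrightarrow> E_r \<Omega> r (\<gamma> s) \<le> E_r \<Omega> r (\<gamma> t)"
      using max_on_path[OF \<Omega> assms(4) \<gamma>, where r = r] by metis
    obtain t' where t': "t' \<in> {-1..1}" "?M r' \<gamma> = E_r \<Omega> r' (\<gamma> t')"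
      "\<And>s. s \<in> {-1..1} \<Longrightarrow> E_r \<Omega> r' (\<gamma> s) \<le> E_r \<Omega> r' (\<gamma> t')"
      using max_on_path[OF \<Omega> assms(4) \<gamma>, where r = r'] by metis
    show "?M r' \<gamma> \<le> ?M r \<gamma>"
      using E_r_change_parameter(1)[OF PP[OF \<gamma> t'(1)] \<open>r \<le> r'\<close>] t(3)[OF t'(1)]
      unfolding t(2) t'(2) by linarith
    show "?M r \<gamma> \<le> ?M r' \<gamma> + (r' - r)"
      using E_r_change_parameter(2)[OF PP[OF \<gamma> t(1)] \<open>r \<le> r'\<close>] t'(3)[OF t(1)]
      unfolding t(2) t'(2) by linarith
  qed
  have bdd: "bdd_below (?M r ` paths \<Omega> \<phi>1)" if "0 \<le> r" for r
  proof (rule bdd_belowI2)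
    fix \<gamma> assume \<gamma>: "\<gamma> \<in> paths \<Omega> \<phi>1"
    obtain t where t: "t \<in> {-1..1}" "?M r \<gamma> = E_r \<Omega> r (\<gamma> t)"
      using max_on_path[OF \<Omega> assms(4) \<gamma>, where r = r] by metis
    have "EL \<phi>1 \<phi>1 \<le> EL (\<gamma> t) (\<gamma> t)"
      using assms(6) PP[OF \<gamma> t(1)]
      by (auto simp: first_eigenfunction_def is_arg_min_def not_less)
    moreover have "E_r \<Omega> 0 (\<gamma> t) \<le> E_r \<Omega> r (\<gamma> t) + r"
      using E_r_change_parameter(2)[OF PP[OF \<gamma> t(1)] \<open>0 \<le> r\<close>] by simp
    ultimately show "EL \<phi>1 \<phi>1 - r \<le> ?M r \<gamma>"
      unfolding t(2) by (simp add: E_r_def)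
  qed
  have level: "c_level \<Omega> \<phi>1 r' \<le> c_level \<Omega> \<phi>1 r" "c_level \<Omega> \<phi>1 r \<le> c_level \<Omega> \<phi>1 r' + (r' - r)"
    if r: "0 \<le> r" "r \<le> r'" for r r'
  proof -
    show "c_level \<Omega> \<phi>1 r' \<le> c_level \<Omega> \<phi>1 r"
      unfolding c_level_def by (rule cINF_mono[OF False bdd]) (use r max(1) in auto)
    have "c_level \<Omega> \<phi>1 r - (r' - r) \<le> c_level \<Omega> \<phi>1 r'"
      unfolding c_level_def[of _ _ r']
    proof (rule cINF_greatest[OF False])
      fix \<gamma> assume \<gamma>: "\<gamma> \<in> paths \<Omega> \<phi>1"
      have "c_level \<Omega> \<phi>1 r \<le> ?M r \<gamma>"
        unfolding c_level_def by (rule cINF_lower[OF bdd[OF r(1)] \<gamma>])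
      then show "c_level \<Omega> \<phi>1 r - (r' - r) \<le> ?M r' \<gamma>"
        using max(2)[OF \<gamma> r(2)] by linarith
    qed
    then show "c_level \<Omega> \<phi>1 r \<le> c_level \<Omega> \<phi>1 r' + (r' - r)" by linarith
  qed
  have "1-lipschitz_on {0..} (c_level \<Omega> \<phi>1)"
  proof (rule lipschitz_onI)
    fix r r' :: real assume "r \<in> {0..}" "r' \<in> {0..}"
    then show "dist (c_level \<Omega> \<phi>1 r) (c_level \<Omega> \<phi>1 r') \<le> 1 * dist r r'"
      using level[of r r'] level[of r' r] by (cases "r \<le> r'") (auto simp: dist_real_def)
  qed simp
  then show ?thesis
    using level(1) by (auto simp: monotone_on_def)
qed

end
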